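(* Let $\mathcal{S} = \{(t_i,p_i)\}_{1\le i\le r}$ be a canonic scheme with at least two voices, and let $$s = \max_i t_i - \min_i t_i$$ be its total time displacement. Then the limit $\lambda(\mathcal{S}) = \lim_{n\to\infty}\sqrt[n]{V_n(\mathcal{S})}$ defining the flexibility exists, and $\lambda(\mathcal{S})$ is an algebraic integer, that is, a root of a polynomial with integer coefficients and leading coefficient $1$, and the degree of this polynomial is at most $\frac{1}{7}V_s(\mathcal{S}) \le 7^{s-1}$.
   Context: Let $\mathbb{F}_7 = \mathbb{Z}/7\mathbb{Z}$. A canonic scheme $\mathcal{S}$ with $r$ voices is a set of ordered pairs $\{(t_i,p_i)\}_{1\le i\le r}$ with time displacements $t_i\in\mathbb{Z}$ and pitch displacements $p_i\in\mathbb{F}_7$, with no two $t_i$ equal, and with one of the ordered pairs optionally bearing the annotation $\mathrm{B}$ (the "marked bass voice"; at most one voice is marked, possibly none). A melody of length $n$ is a sequence $[x_1,\ldots,x_n]$ with $x_i\in\mathbb{F}_7$. Its realization under $\mathcal{S}$ is given by $y_{ti} = x_{t-t_i}+p_i$ (the note sung by voice $i$ at time $t\in\mathbb{Z}$), which exists exactly when $1\le t-t_i\le n$. A melody of length $n$ is a valid canon for $\mathcal{S}$ if for all voices $i,j$ and all $t\in\mathbb{Z}$ such that $y_{ti}$ and $y_{tj}$ both exist (i.e. $1\le t-t_i\le n$ and $1\le t-t_j\le n$): (a) $y_{ti}-y_{tj}\notin\{1,6\}$; and (b) if voice $j$ is the marked bass voice, then $y_{ti}-y_{tj}\ne 3$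 (all in $\mathbb{F}_7$). $V_n(\mathcal{S})$ denotes the number of valid canons of length $n$ for $\mathcal{S}$. The flexibility of $\mathcal{S}$ is $\lambda(\mathcal{S}) = \lim_{n\to\infty}\sqrt[n]{V_n(\mathcal{S})}$.
   Formalization: When V_s(S) = 0 (which can happen, e.g. voices (0,0),(1,1),(2,5),(3,0),(4,5)), no monic polynomial of degree at most 0 has a root, so in that case the degree bound is taken to be 1 instead of V_s(S)/7. *)

theory Defs
  imports Complex_Main "HOL-Library.Numeral_Type" "HOL-Computational_Algebra.Polynomial"
begin

text \<open>The type \<open>7\<close> of \<^theory>\<open>HOL-Library.Numeral_Type\<close> is the ring of integers
  modulo 7. A voice is a pair (time displacement, pitch displacement).\<close>

type_synonym voice = "int \<times> 7"

record scheme =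
  voices :: "voice set"
  bass :: "voice option"

definition canonic_scheme :: "scheme \<Rightarrow> bool" where
  "canonic_scheme S \<longleftrightarrow>
     finite (voices S) \<and> inj_on fst (voices S) \<and> set_option (bass S) \<subseteq> voices S"

text \<open>The melody \<open>[x\<^sub>1, \<dots>, x\<^sub>n]\<close> is a list, so \<open>x\<^sub>k\<close> is \<open>xs ! (k - 1)\<close>.
  \<open>note_exists\<close> says that \<open>1 \<le> t - t\<^sub>i \<le> n\<close>; the value of \<open>sung_note\<close> is only
  meaningful in that case.\<close>

definition note_exists :: "7 list \<Rightarrow> voice \<Rightarrow> int \<Rightarrow> bool" where
  "note_exists xs v t \<longleftrightarrow> 1 \<le> t - fst v \<and> t - fst v \<le> int (length xs)"

definition sung_note :: "7 list \<Rightarrow> voice \<Rightarrow> int \<Rightarrow> 7" where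
  "sung_note xs v t = xs ! (nat (t - fst v) - 1) + snd v"

definition valid_canon :: "scheme \<Rightarrow> 7 list \<Rightarrow> bool" where
  "valid_canon S xs \<longleftrightarrow>
     (\<forall>v \<in> voices S. \<forall>w \<in> voices S. \<forall>t. note_exists xs v t \<and> note_exists xs w t \<longrightarrow>
        sung_note xs v t - sung_note xs w t \<notin> {1, 6} \<and>
        (bass S = Some w \<longrightarrow> sung_note xs v t - sung_note xs w t \<noteq> 3))"

definition num_canons :: "scheme \<Rightarrow> nat \<Rightarrow> nat" where
  "num_canons S n = card {xs. length xs = n \<and> valid_canon S xs}"

definition flexibility :: "scheme \<Rightarrow> real" where
  "flexibility S = lim (\<lambda>n. root n (real (num_canons S n)))"

definition total_displacement :: "scheme \<Rightarrow> nat" where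
  "total_displacement S = nat (Max (fst ` voices S) - Min (fst ` voices S))"

end

theory Submission
  imports Defs "Jordan_Normal_Form.Char_Poly"
begin

text \<open>Up to transposition, the valid canons of length \<open>s\<close> are the states of a transfer matrix
  \<open>M\<close>, and \<open>V\<^sub>n\<^sub>+\<^sub>s / 7\<close> is the sum of the entries of \<open>M\<^sup>n 1\<close>. By submultiplicativity the limit
  \<open>L\<close> exists and \<open>L\<^sup>n \<le> V\<^sub>n\<close>. Perron-Frobenius theory is not needed: if \<open>L > 0\<close> were not an
  eigenvalue of \<open>M\<close>, then telescoping \<open>g\<^sub>n = L (L I - M)\<^sup>-\<^sup>1 (g\<^sub>n - g\<^sub>n\<^sub>+\<^sub>1)\<close> for
  \<open>g\<^sub>n = L\<^sup>-\<^sup>n M\<^sup>n 1\<close> would bound the partial sums of the nonnegative vectors \<open>g\<^sub>n\<close> by a constant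
  times the next term. Since the entry sums of \<open>g\<^sub>n\<close> stay away from 0, they would grow
  exponentially, contradicting the definition of \<open>L\<close>.\<close>

section \<open>Growth rates\<close>

text \<open>Multiplicative form of Fekete's lemma, proved without logarithms because
  \<open>V n\<close> may be 0. The limit is the infimum of the roots, which is why it bounds every
  single term from below.\<close>

lemma submultiplicative_root_tendsto:
  fixes V :: "nat \<Rightarrow> nat"
  assumes sub: "\<And>m n. V (m + n) \<le> V m * V n"
  shows "\<exists>L\<ge>0. (\<lambda>n. root n (real (V n))) \<longlonglongrightarrow> L \<and> (\<forall>n>0. L ^ n \<le> real (V n))"
proof -
  let ?r = "\<lambda>n. root n (real (V n))"
  define L where "L = (INF n\<in>{0<..}. ?r n)"
  have bdd: "bdd_below (?r ` {0<..})"
    by (rule bdd_belowI[of _ 0]) auto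
  have L_le: "L \<le> ?r n" if "n > 0" for n
    unfolding L_def using bdd that by (intro cINF_lower) auto
  have L0: "L \<ge> 0"
    unfolding L_def by (intro cINF_greatest) auto
  have "L ^ n \<le> real (V n)" if "n > 0" for n
  proof -
    have "L ^ n \<le> ?r n ^ n" using L_le[OF that] L0 by (intro power_mono)
    then show ?thesis using that by simp
  qed
  moreover have "?r \<longlonglongrightarrow> L"
  proof (rule order_tendstoI)
    fix a assume a: "a < L"
    show "eventually (\<lambda>n. a < ?r n) sequentially"
      using eventually_gt_at_top[of 0] by eventually_elim (rule less_le_trans[OF a L_le])
  next
    fix a assume a: "L < a"
    \<comment> \<open>The gap between \<open>r\<close> and \<open>a\<close> absorbs the factor
      \<open>root n C\<close>, which tends to 1.\<close>
    define r where "r = (L + a) / 2"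
    have r: "L < r" "r < a" "r > 0" using a L0 unfolding r_def by auto
    obtain k where k: "k > 0" "?r k < r"
      using cINF_less_iff[OF _ bdd, of r] r(1) unfolding L_def by auto
    have Vk: "real (V k) \<le> r ^ k"
    proof -
      have "?r k ^ k \<le> r ^ k" using k by (intro power_mono) auto
      then show ?thesis using k by simp
    qed
    \<comment> \<open>\<open>C\<close> pays for the remainders \<open>n mod k\<close>; the inserted
      1 keeps it positive, so that its roots tend to 1.\<close>
    define C where "C = Max (insert 1 ((\<lambda>j. real (V j) / r ^ j) ` {..<k}))"
    have C1: "C \<ge> 1" unfolding C_def by (intro Max_ge) auto
    have C: "real (V j) \<le> C * r ^ j" if "j < k" for j
    proof -
      have "real (V j) / r ^ j \<le> C" unfolding C_def using that by (intro Max_ge) auto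
      then show ?thesis using r by (simp add: field_simps)
    qed
    have iter: "real (V (q * k + j)) \<le> real (V k) ^ q * real (V j)" for q j
    proof (induction q)
      case (Suc q)
      have "real (V (Suc q * k + j)) \<le> real (V k) * real (V (q * k + j))"
        using sub[of k "q * k + j"] by (simp add: add.assoc flip: of_nat_mult)
      also have "\<dots> \<le> real (V k) * (real (V k) ^ q * real (V j))"
        using Suc by (intro mult_left_mono) auto
      finally show ?case by (simp add: mult.assoc)
    qed simp
    have V_le: "real (V n) \<le> C * r ^ n" for n
    proof -
      have "real (V n) \<le> real (V k) ^ (n div k) * real (V (n mod k))"
        using iter[of "n div k" "n mod k"] by simp
      also have "\<dots> \<le> (r ^ k) ^ (n div k) * (C * r ^ (n mod k))"
        using Vk C k r by (intro mult_mono power_mono) auto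
      also have "\<dots> = C * (r ^ (k * (n div k)) * r ^ (n mod k))" by (simp add: power_mult)
      also have "\<dots> = C * r ^ n" by (simp flip: power_add)
      finally show ?thesis .
    qed
    have le: "?r n \<le> root n C * r" if "n > 0" for n
    proof -
      have "?r n \<le> root n (C * r ^ n)" using V_le that by (intro real_root_le_mono)
      also have "\<dots> = root n C * r" using that r by (simp add: real_root_mult real_root_power_cancel)
      finally show ?thesis .
    qed
    have "(\<lambda>n. root n C * r) \<longlonglongrightarrow> 1 * r"
      using C1 by (intro tendsto_intros LIMSEQ_root_const) auto
    then have "eventually (\<lambda>n. root n C * r < a) sequentially"
      using r by (intro order_tendstoD(2)[of _ "1 * r"]) auto
    then show "eventually (\<lambda>n. ?r n < a) sequentially"
      using eventually_gt_at_top[of 0] by eventually_elim (rule le_less_trans[OF le])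
  qed
  ultimately show ?thesis using L0 by blast
qed

text \<open>A term at least proportional to the sum of all earlier ones multiplies that sum by a
  fixed factor above 1. The additive \<open>K\<close> is harmless because terms bounded away from 0
  push the sum past it.\<close>

lemma exponential_growth_if_sum_bounded:
  fixes b :: "nat \<Rightarrow> real"
  assumes lower: "\<And>n. b n \<ge> c" "c > 0"
    and sum: "\<And>N. (\<Sum>n<N. b n) \<le> K * (1 + b N)" and K: "K > 0"
  obtains C q N\<^sub>0 where "C > 0" "q > 1" "\<And>N. N \<ge> N\<^sub>0 \<Longrightarrow> C * q ^ N \<le> b N"
proof -
  \<comment> \<open>Subtracting \<open>K\<close> makes the hypothesis homogeneous:
    \<open>T N \<le> K * b N\<close>.\<close>
  define T where "T N = (\<Sum>n<N. b n) - K" for N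
  define q where "q = 1 + 1 / K"
  have q: "q > 1" using K by (simp add: q_def)
  have T_b: "T N / K \<le> b N" for N
    using sum[of N] K by (simp add: T_def pos_divide_le_eq algebra_simps)
  have T_step: "q * T N \<le> T (Suc N)" for N
  proof -
    have "q * T N = T N + T N / K" by (simp add: q_def algebra_simps)
    also have "\<dots> \<le> T N + b N" using T_b by simp
    finally show ?thesis by (simp add: T_def)
  qed
  have "real N * c \<le> (\<Sum>n<N. b n)" for N
    using sum_bounded_below[of "{..<N}" c b] lower by simp
  moreover obtain N\<^sub>0 where "K < real N\<^sub>0 * c"
    using reals_Archimedean3[OF lower(2)] by blast
  ultimately have T0: "T N\<^sub>0 > 0" unfolding T_def by (metis diff_gt_0_iff_gt less_le_trans)
  have T_ge: "T N\<^sub>0 * q ^ d \<le> T (N\<^sub>0 + d)" for d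
  proof (induction d)
    case (Suc d)
    have "T N\<^sub>0 * q ^ Suc d \<le> q * T (N\<^sub>0 + d)"
      using Suc q by (simp add: mult.left_commute)
    also have "\<dots> \<le> T (N\<^sub>0 + Suc d)" using T_step by simp
    finally show ?case .
  qed simp
  show thesis
  proof
    show "T N\<^sub>0 / (K * q ^ N\<^sub>0) > 0" using T0 K q by simp
    show "q > 1" by (fact q)
    fix N assume "N \<ge> N\<^sub>0"
    then obtain d where d: "N = N\<^sub>0 + d" using le_Suc_ex by blast
    have "T N\<^sub>0 / (K * q ^ N\<^sub>0) * q ^ N = T N\<^sub>0 * q ^ d / K"
      using q K by (simp add: d power_add)
    also have "\<dots> \<le> T N / K" using T_ge[of d] K by (simp add: d divide_right_mono)
    also have "\<dots> \<le> b N" by (fact T_b)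
    finally show "T N\<^sub>0 / (K * q ^ N\<^sub>0) * q ^ N \<le> b N" .
  qed
qed

section \<open>Linear recurrences with integer matrices\<close>

text \<open>The witness is the characteristic polynomial of \<open>M\<close> on \<open>Q\<close>.
  Away from its roots L I - M is invertible, with inverse \<open>B\<close> the same for all
  \<open>f\<close>. Functions on \<open>Q\<close> take the place of vectors, so that states need no
  numbering elsewhere.\<close>

lemma char_poly_inverse_on_finite_set:
  fixes M :: "'a \<Rightarrow> 'a \<Rightarrow> int" and L :: real
  assumes fin: "finite Q"
  shows "\<exists>p :: int poly. lead_coeff p = 1 \<and> degree p = card Q \<and>
    (poly (map_poly of_int p) L \<noteq> 0 \<longrightarrow>
      (\<exists>B. \<forall>f. \<forall>i\<in>Q. f i = (\<Sum>j\<in>Q. B i j * (L * f j - (\<Sum>k\<in>Q. of_int (M j k) * f k)))))"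
proof -
  define m where "m = card Q"
  obtain h where h: "bij_betw h {0..<m} Q"
    unfolding m_def using ex_bij_betw_nat_finite[OF fin] by blast
  define g where "g = the_inv_into {0..<m} h"
  have g: "g i < m" "h (g i) = i" if "i \<in> Q" for i
    using that h bij_betwE[OF bij_betw_the_inv_into[OF h]] f_the_inv_into_f_bij_betw[OF h]
    unfolding g_def by auto
  have gh: "g (h i) = i" if "i < m" for i
    using that h unfolding g_def by (simp add: bij_betw_def the_inv_into_f_f)
  have reindex: "(\<Sum>j\<in>Q. F j) = (\<Sum>j=0..<m. F (h j))" for F :: "'a \<Rightarrow> real"
    using sum.reindex_bij_betw[OF h] by metis
  define A where "A = mat m m (\<lambda>(i, j). M (h i) (h j))"
  define A' where "A' = map_mat real_of_int A"
  have A: "A \<in> carrier_mat m m" and A': "A' \<in> carrier_mat m m"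
    by (auto simp: A_def A'_def)
  show ?thesis
  proof (intro exI[of _ "char_poly A"] conjI impI)
    show "degree (char_poly A) = card Q" "lead_coeff (char_poly A) = 1"
      using degree_monic_char_poly[OF A] by (auto simp: m_def)
    assume "poly (map_poly of_int (char_poly A)) L \<noteq> 0"
    then have det: "det (- char_matrix A' L) \<noteq> 0"
      using char_poly_matrix[OF A', of L] of_int_hom.char_poly_hom[OF A, where 'a=real]
      by (simp add: A'_def)
    \<comment> \<open>The sign makes \<open>D\<close> equal to L I - M.\<close>
    define D where "D = - char_matrix A' L"
    have D: "D \<in> carrier_mat m m" unfolding D_def using A' by simp
    obtain B where B: "B \<in> carrier_mat m m" "B * D = 1\<^sub>m m"
      using det_non_zero_imp_unit[OF D det[folded D_def], of "()"]
      by (auto simp: Units_def ring_mat_simps)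
    have "f i = (\<Sum>j\<in>Q. B $$ (g i, g j) * (L * f j - (\<Sum>k\<in>Q. of_int (M j k) * f k)))"
      if i: "i \<in> Q" for f :: "'a \<Rightarrow> real" and i
    proof -
      define v where "v = vec m (\<lambda>j. f (h j))"
      have v: "v \<in> carrier_vec m" by (simp add: v_def)
      have Dv: "(D *\<^sub>v v) $ j = L * f (h j) - (\<Sum>k\<in>Q. of_int (M (h j) k) * f k)" if "j < m" for j
      proof -
        have "(D *\<^sub>v v) $ j = (\<Sum>k=0..<m. D $$ (j, k) * f (h k))"
          using that D by (simp add: scalar_prod_def v_def)
        also have "\<dots> = (\<Sum>k=0..<m. (if j = k then L * f (h k) else 0) - of_int (M (h j) (h k)) * f (h k))"
          using that by (intro sum.cong)
            (auto simp: D_def char_matrix_def A'_def A_def algebra_simps)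
        also have "\<dots> = L * f (h j) - (\<Sum>k=0..<m. of_int (M (h j) (h k)) * f (h k))"
          using that by (simp add: sum_subtractf sum.delta)
        finally show ?thesis by (simp add: reindex)
      qed
      have "f i = v $ g i" using g i by (simp add: v_def)
      also have "v = B *\<^sub>v (D *\<^sub>v v)"
        using B D v by (metis assoc_mult_mat_vec one_mult_mat_vec)
      also have "(B *\<^sub>v (D *\<^sub>v v)) $ g i = (\<Sum>j=0..<m. B $$ (g i, j) * (D *\<^sub>v v) $ j)"
        using g i B D by (simp add: scalar_prod_def)
      also have "\<dots> = (\<Sum>j\<in>Q. B $$ (g i, g j) * (L * f j - (\<Sum>k\<in>Q. of_int (M j k) * f k)))"
        unfolding reindex[of "\<lambda>j. B $$ (g i, g j) * _ j"] using Dv gh by (intro sum.cong) auto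
      finally show ?thesis .
    qed
    then show "\<exists>B. \<forall>f. \<forall>i\<in>Q. f i = (\<Sum>j\<in>Q. B i j * (L * f j - (\<Sum>k\<in>Q. of_int (M j k) * f k)))"
      by (intro exI[of _ "\<lambda>i j. B $$ (g i, g j)"]) blast
  qed
qed

text \<open>The assumptions \<open>lower\<close> and \<open>no_excess\<close> fix L as the growth
  rate: the entry sums never fall below order L^n, and no rate q L with q > 1 is a lower bound from
  some index on. The latter is what a non-eigenvalue L would violate.\<close>

lemma linear_recurrence_growth_rate:
  fixes M :: "'a \<Rightarrow> 'a \<Rightarrow> int" and f :: "nat \<Rightarrow> 'a \<Rightarrow> real" and L :: real
  assumes fin: "finite Q" and L: "L > 0"
    and rec: "\<And>n i. i \<in> Q \<Longrightarrow> f (Suc n) i = (\<Sum>j\<in>Q. of_int (M i j) * f n j)"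
    and nonneg: "\<And>n i. f n i \<ge> 0"
    and lower: "\<And>n. c * L ^ n \<le> (\<Sum>i\<in>Q. f n i)" "c > 0"
    and no_excess: "\<And>C q N\<^sub>0. C > 0 \<Longrightarrow> q > 1 \<Longrightarrow>
      \<exists>N\<ge>N\<^sub>0. (\<Sum>i\<in>Q. f N i) < C * (q * L) ^ N"
  shows "\<exists>p :: int poly. lead_coeff p = 1 \<and> degree p = card Q \<and> poly (map_poly of_int p) L = 0"
proof -
  obtain p :: "int poly" where p: "lead_coeff p = 1" "degree p = card Q"
    and inv: "poly (map_poly of_int p) L \<noteq> 0 \<Longrightarrow>
      \<exists>B. \<forall>f. \<forall>i\<in>Q. f i = (\<Sum>j\<in>Q. B i j * (L * f j - (\<Sum>k\<in>Q. of_int (M j k) * f k)))"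
    using char_poly_inverse_on_finite_set[OF fin, of L M] by blast
  have "poly (map_poly of_int p) L = 0"
  proof (rule ccontr)
    assume "poly (map_poly of_int p) L \<noteq> 0"
    from inv[OF this] obtain B where
      "\<forall>f. \<forall>i\<in>Q. f i = (\<Sum>j\<in>Q. B i j * (L * f j - (\<Sum>k\<in>Q. of_int (M j k) * f k)))"
      by (elim exE)
    note B = this[rule_format]
    define g where "g n i = f n i / L ^ n" for n i
    define b where "b n = (\<Sum>i\<in>Q. g n i)" for n
    have g0: "g n i \<ge> 0" for n i using nonneg L by (simp add: g_def)
    have b_eq: "b n = (\<Sum>i\<in>Q. f n i) / L ^ n" for n
      by (simp add: b_def g_def sum_divide_distrib)
    \<comment> \<open>By the recurrence, (L I - M) applied to \<open>f n\<close> is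
      \<open>L * f n - f (Suc n)\<close>; division by \<open>L ^ n\<close> turns this into L times a
      difference of consecutive \<open>g\<close>, ready to telescope.\<close>
    have g_step: "g n i = (\<Sum>j\<in>Q. L * B i j * (g n j - g (Suc n) j))" if "i \<in> Q" for n i
    proof -
      have "g n i = (\<Sum>j\<in>Q. B i j * (L * f n j - f (Suc n) j)) / L ^ n"
        using B[OF that, of "f n"] rec by (simp add: g_def)
      also have "\<dots> = (\<Sum>j\<in>Q. L * B i j * (g n j - g (Suc n) j))"
        unfolding sum_divide_distrib g_def using L by (intro sum.cong refl) (simp add: field_simps)
      finally show ?thesis .
    qed
    have g_sum: "(\<Sum>n<N. g n i) = (\<Sum>j\<in>Q. L * B i j * (g 0 j - g N j))" if "i \<in> Q" for N i
    proof -
      have "(\<Sum>n<N. g n i) = (\<Sum>n<N. \<Sum>j\<in>Q. L * B i j * (g n j - g (Suc n) j))"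
        using g_step[OF that] by (intro sum.cong) auto
      also have "\<dots> = (\<Sum>j\<in>Q. L * B i j * (\<Sum>n<N. g n j - g (Suc n) j))"
        by (subst sum.swap) (simp only: sum_distrib_left)
      also have "\<dots> = (\<Sum>j\<in>Q. L * B i j * (g 0 j - g N j))"
        by (simp only: sum_lessThan_telescope'[of "\<lambda>n. g n _"])
      finally show ?thesis .
    qed
    define K\<^sub>0 where "K\<^sub>0 = (\<Sum>i\<in>Q. \<Sum>j\<in>Q. \<bar>L * B i j\<bar>)"
    have K0: "K\<^sub>0 \<ge> 0" unfolding K\<^sub>0_def by (intro sum_nonneg) auto
    \<comment> \<open>The factor \<open>1 + b 0\<close> comes from bounding \<open>b 0 + b N\<close>
      by \<open>(1 + b 0) * (1 + b N)\<close>; the final 1 makes \<open>K\<close> positive even if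
      \<open>B\<close> vanishes on \<open>Q\<close>.\<close>
    define K where "K = K\<^sub>0 * (1 + b 0) + 1"
    have b0: "b n \<ge> 0" for n unfolding b_def using g0 by (intro sum_nonneg)
    have g_le_b: "g n j \<le> b n" if "j \<in> Q" for n j
      unfolding b_def using g0 fin that by (intro member_le_sum) auto
    have b_sum: "(\<Sum>n<N. b n) \<le> K * (1 + b N)" for N
    proof -
      have "(\<Sum>n<N. b n) = (\<Sum>i\<in>Q. \<Sum>j\<in>Q. L * B i j * (g 0 j - g N j))"
        unfolding b_def using g_sum by (subst sum.swap) (intro sum.cong refl)
      also have "\<dots> \<le> (\<Sum>i\<in>Q. \<Sum>j\<in>Q. \<bar>L * B i j\<bar> * (b 0 + b N))"
      proof (intro sum_mono)
        fix i j assume "j \<in> Q"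
        then have "\<bar>g 0 j - g N j\<bar> \<le> b 0 + b N"
          using g_le_b[of j 0] g_le_b[of j N] g0[of 0 j] g0[of N j] by linarith
        then have "\<bar>L * B i j * (g 0 j - g N j)\<bar> \<le> \<bar>L * B i j\<bar> * (b 0 + b N)"
          unfolding abs_mult[of "L * B i j"] by (intro mult_left_mono) auto
        then show "L * B i j * (g 0 j - g N j) \<le> \<bar>L * B i j\<bar> * (b 0 + b N)" by linarith
      qed
      also have "\<dots> = K\<^sub>0 * (b 0 + b N)" by (simp add: K\<^sub>0_def sum_distrib_right)
      also have "\<dots> \<le> K\<^sub>0 * ((1 + b 0) * (1 + b N))"
        using K0 b0 by (intro mult_left_mono) (simp_all add: algebra_simps)
      also have "\<dots> \<le> K * (1 + b N)" using b0[of N] by (simp add: K_def algebra_simps)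
      finally show ?thesis .
    qed
    have "K > 0" unfolding K_def using K0 b0[of 0] by (simp add: add_nonneg_pos)
    moreover have "b n \<ge> c" for n
      using lower(1)[of n] L by (simp add: b_eq field_simps)
    ultimately obtain C q N\<^sub>0 where Cq: "C > 0" "q > 1" "\<And>N. N \<ge> N\<^sub>0 \<Longrightarrow> C * q ^ N \<le> b N"
      using exponential_growth_if_sum_bounded[of c b K] lower(2) b_sum by metis
    obtain N where N: "N \<ge> N\<^sub>0" "(\<Sum>i\<in>Q. f N i) < C * (q * L) ^ N"
      using no_excess[OF Cq(1,2)] by blast
    have "C * q ^ N * L ^ N \<le> (\<Sum>i\<in>Q. f N i)"
      using Cq(3)[OF N(1)] L by (simp add: b_eq field_simps)
    with N(2) show False by (simp add: power_mult_distrib)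
  qed
  then show ?thesis using p by blast
qed

section \<open>Valid canons\<close>

text \<open>Eliminates the time t: positions i and j, counted from 0, sound together exactly when
  their shifted positions agree. Validity of prefixes and suffixes then becomes list
  indexing.\<close>

lemma valid_canon_iff:
  "valid_canon S xs \<longleftrightarrow>
     (\<forall>v\<in>voices S. \<forall>w\<in>voices S. \<forall>i<length xs. \<forall>j<length xs.
        int i + fst v = int j + fst w \<longrightarrow>
        xs ! i + snd v - (xs ! j + snd w) \<notin> {1, 6} \<and>
        (bass S = Some w \<longrightarrow> xs ! i + snd v - (xs ! j + snd w) \<noteq> 3))"
  (is "_ \<longleftrightarrow> (\<forall>v\<in>_. \<forall>w\<in>_. \<forall>i<_. \<forall>j<_. _ \<longrightarrow> ?P v w i j)")
proof (intro iffI ballI allI impI)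
  fix v w i j
  assume "valid_canon S xs" and vw: "v \<in> voices S" "w \<in> voices S"
    and ij: "i < length xs" "j < length xs" "int i + fst v = int j + fst w"
  \<comment> \<open>The 1 converts list indices, starting at 0, to melody positions, starting at
    1.\<close>
  define t where "t = int i + 1 + fst v"
  have t: "t - fst v = int (Suc i)" "t - fst w = int (Suc j)" using ij(3) by (auto simp: t_def)
  then have "note_exists xs v t" "note_exists xs w t"
    using ij by (auto simp: note_exists_def)
  moreover have "sung_note xs v t - sung_note xs w t = xs ! i + snd v - (xs ! j + snd w)"
    unfolding sung_note_def t nat_int by simp
  ultimately show "?P v w i j"
    using \<open>valid_canon S xs\<close> vw unfolding valid_canon_def by metis
next
  assume R: "\<forall>v\<in>voices S. \<forall>w\<in>voices S. \<forall>i<length xs. \<forall>j<length xs.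
    int i + fst v = int j + fst w \<longrightarrow> ?P v w i j"
  show "valid_canon S xs"
    unfolding valid_canon_def
  proof (intro ballI allI impI, elim conjE)
    fix v w t
    assume vw: "v \<in> voices S" "w \<in> voices S" and ex: "note_exists xs v t" "note_exists xs w t"
    define i j where "i = nat (t - fst v) - 1" and "j = nat (t - fst w) - 1"
    have "i < length xs" "j < length xs" "int i + fst v = int j + fst w"
      using ex by (auto simp: i_def j_def note_exists_def)
    with R vw have "?P v w i j" by blast
    then show "sung_note xs v t - sung_note xs w t \<notin> {1, 6} \<and>
      (bass S = Some w \<longrightarrow> sung_note xs v t - sung_note xs w t \<noteq> 3)"
      unfolding sung_note_def i_def j_def .
  qed
qed

text \<open>A prefix keeps its indices. In a suffix both indices shift by \<open>length xs\<close>,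
  which leaves the condition of sounding together unchanged.\<close>

lemma valid_canon_appendD:
  assumes "valid_canon S (xs @ ys)"
  shows "valid_canon S xs" "valid_canon S ys"
proof -
  show "valid_canon S xs"
    unfolding valid_canon_iff
  proof (intro ballI allI impI)
    fix v w i j
    assume "v \<in> voices S" "w \<in> voices S" "i < length xs" "j < length xs"
      "int i + fst v = int j + fst w"
    then show "xs ! i + snd v - (xs ! j + snd w) \<notin> {1, 6} \<and>
        (bass S = Some w \<longrightarrow> xs ! i + snd v - (xs ! j + snd w) \<noteq> 3)"
      using assms[unfolded valid_canon_iff, rule_format, of v w i j]
      by (simp add: nth_append)
  qed
  show "valid_canon S ys"
    unfolding valid_canon_iff
  proof (intro ballI allI impI)
    fix v w i j
    assume "v \<in> voices S" "w \<in> voices S" "i < length ys" "j < length ys"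
      "int i + fst v = int j + fst w"
    then show "ys ! i + snd v - (ys ! j + snd w) \<notin> {1, 6} \<and>
        (bass S = Some w \<longrightarrow> ys ! i + snd v - (ys ! j + snd w) \<noteq> 3)"
      using assms[unfolded valid_canon_iff, rule_format, of v w "length xs + i" "length xs + j"]
      by (simp add: nth_append)
  qed
qed

lemma valid_canon_transpose [simp]: "valid_canon S (map ((+) c) xs) \<longleftrightarrow> valid_canon S xs"
  unfolding valid_canon_iff by (simp add: algebra_simps)

lemma total_displacement_bound:
  assumes "canonic_scheme S" "v \<in> voices S" "w \<in> voices S"
  shows "fst v - fst w \<le> int (total_displacement S)"
proof -
  have fin: "finite (fst ` voices S)" using assms(1) by (simp add: canonic_scheme_def)
  have "fst v \<le> Max (fst ` voices S)" "Min (fst ` voices S) \<le> fst w"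
    using fin assms by auto
  then show ?thesis unfolding total_displacement_def by linarith
qed

text \<open>Distinct voices enter at distinct times. Positivity ensures that a window of length s
  has a first note by which it can be normalized.\<close>

lemma total_displacement_pos:
  assumes "canonic_scheme S" "card (voices S) \<ge> 2"
  shows "total_displacement S > 0"
proof -
  have "\<not> card (fst ` voices S) \<le> 1"
    using assms by (simp add: canonic_scheme_def card_image)
  moreover have "finite (fst ` voices S)" using assms(1) by (simp add: canonic_scheme_def)
  ultimately obtain v w where vw: "v \<in> voices S" "w \<in> voices S" "fst v \<noteq> fst w"
    by (auto simp: card_le_Suc0_iff_eq)
  then show ?thesis
    using total_displacement_bound[OF assms(1), of v w] total_displacement_bound[OF assms(1), of w v]
    by linarith
qed

text \<open>Two notes that sound together are at most the total displacement apart in the melody,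
  so validity can be checked on windows one longer than that.\<close>

lemma valid_canon_append_Cons_iff:
  assumes S: "canonic_scheme S" and len: "length w = total_displacement S" "w \<noteq> []"
  shows "valid_canon S (w @ x # zs) \<longleftrightarrow> valid_canon S (w @ [x]) \<and> valid_canon S (tl w @ x # zs)"
proof
  assume *: "valid_canon S (w @ x # zs)"
  have "w @ x # zs = (w @ [x]) @ zs" "w @ x # zs = [hd w] @ (tl w @ x # zs)"
    using len by simp_all
  with * show "valid_canon S (w @ [x]) \<and> valid_canon S (tl w @ x # zs)"
    using valid_canon_appendD by metis
next
  assume *: "valid_canon S (w @ [x]) \<and> valid_canon S (tl w @ x # zs)"
  let ?xs = "w @ x # zs"
  have first: "(w @ [x]) ! i = ?xs ! i" if "i \<le> length w" for i
    using that by (auto simp: nth_append)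
  have rest: "(tl w @ x # zs) ! i = ?xs ! Suc i" for i
    using len(2) by (cases w) simp_all
  show "valid_canon S ?xs"
    unfolding valid_canon_iff
  proof (intro ballI allI impI)
    fix v u i j
    assume vu: "v \<in> voices S" "u \<in> voices S"
      and ij: "i < length ?xs" "j < length ?xs" "int i + fst v = int j + fst u"
    have dist: "\<bar>int i - int j\<bar> \<le> int (length w)"
      using total_displacement_bound[OF S vu] total_displacement_bound[OF S vu(2,1)] ij(3) len(1)
      by linarith
    show "?xs ! i + snd v - (?xs ! j + snd u) \<notin> {1, 6} \<and>
        (bass S = Some u \<longrightarrow> ?xs ! i + snd v - (?xs ! j + snd u) \<noteq> 3)"
    \<comment> \<open>A constraint on the first note reaches at most \<open>length w\<close>
      positions ahead, hence lies within \<open>w @ [x]\<close>; every other constraint lives in the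
      tail.\<close>
    proof (cases "i = 0 \<or> j = 0")
      case True
      then have le: "i \<le> length w" "j \<le> length w" using dist by auto
      then show ?thesis
        using conjunct1[OF *, unfolded valid_canon_iff, rule_format, of v u i j] vu ij(3)
        by (simp add: first)
    next
      case False
      then obtain i' j' where "i = Suc i'" "j = Suc j'" by (metis not0_implies_Suc)
      then show ?thesis
        using conjunct2[OF *, unfolded valid_canon_iff, rule_format, of v u i' j'] vu ij len(2)
        by (simp add: rest)
    qed
  qed
qed

section \<open>Counting valid canons\<close>

lemma finite_melodies [simp]: "finite {xs :: 7 list. length xs = n \<and> P xs}"
  using finite_lists_length_eq[of "UNIV :: 7 set" n] by (auto intro: rev_finite_subset)

lemma num_canons_le: "num_canons S n \<le> 7 ^ n"
proof -
  have "num_canons S n \<le> card {xs :: 7 list. set xs \<subseteq> UNIV \<and> length xs = n}"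
    unfolding num_canons_def by (intro card_mono finite_lists_length_eq) auto
  then show ?thesis using card_lists_length_eq[of "UNIV :: 7 set" n] by simp
qed

text \<open>Cutting a valid canon after m notes leaves two valid canons, which determine it.\<close>

lemma num_canons_submultiplicative: "num_canons S (m + n) \<le> num_canons S m * num_canons S n"
proof -
  let ?V = "\<lambda>n. {xs. length xs = n \<and> valid_canon S xs}"
  have "?V (m + n) \<subseteq> (\<lambda>(xs, ys). xs @ ys) ` (?V m \<times> ?V n)"
  proof
    fix xs assume xs: "xs \<in> ?V (m + n)"
    then have "valid_canon S (take m xs)" "valid_canon S (drop m xs)"
      using valid_canon_appendD[of S "take m xs" "drop m xs"] by auto
    with xs have "(take m xs, drop m xs) \<in> ?V m \<times> ?V n" by auto
    then show "xs \<in> (\<lambda>(xs, ys). xs @ ys) ` (?V m \<times> ?V n)" by (rule image_eqI[rotated]) simp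
  qed
  then have "card (?V (m + n)) \<le> card (?V m \<times> ?V n)"
    by (intro surj_card_le) auto
  then show ?thesis by (simp add: num_canons_def card_cartesian_product)
qed

section \<open>Extensions of a window and transposition classes\<close>

text \<open>For a state \<open>w\<close>, the cardinality of this set is the entry at
  \<open>w\<close> of the vector M^n 1.\<close>

definition extensions :: "scheme \<Rightarrow> nat \<Rightarrow> 7 list \<Rightarrow> 7 list set" where
  "extensions S n w = {zs. length zs = n \<and> valid_canon S (w @ zs)}"

lemma finite_extensions [simp]: "finite (extensions S n w)"
  by (simp add: extensions_def)

text \<open>Allows a window to be replaced by its normalized representative, so that one state per
  transposition class suffices.\<close>

lemma card_extensions_transpose [simp]:
  "card (extensions S n (map ((+) c) w)) = card (extensions S n w)"
proof (rule bij_betw_same_card[symmetric], rule bij_betw_byWitness)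
  let ?f = "\<lambda>c. map ((+) (c :: 7)) :: 7 list \<Rightarrow> 7 list"
  show "\<forall>zs\<in>extensions S n w. ?f (- c) (?f c zs) = zs"
    "\<forall>zs\<in>extensions S n (?f c w). ?f c (?f (- c) zs) = zs"
    by (simp_all add: comp_def map_idI)
  show "?f c ` extensions S n w \<subseteq> extensions S n (?f c w)"
    by (auto simp: extensions_def simp flip: map_append)
  have "valid_canon S (w @ ?f (- c) zs) \<longleftrightarrow> valid_canon S (?f c w @ zs)" for zs
    using valid_canon_transpose[of S c "w @ ?f (- c) zs"] by (simp add: comp_def)
  then show "?f (- c) ` extensions S n (?f c w) \<subseteq> extensions S n w"
    by (auto simp: extensions_def)
qed

text \<open>The states of the transfer matrix: each transposition class of valid canons of length
  \<open>n > 0\<close> has exactly one member with initial note 0. For \<open>n = 0\<close>, \<open>hd\<close> is junk.\<close>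

definition canon_states :: "scheme \<Rightarrow> nat \<Rightarrow> 7 list set" where
  "canon_states S n = {w. length w = n \<and> hd w = 0 \<and> valid_canon S w}"

definition normalize_melody :: "7 list \<Rightarrow> 7 list" where
  "normalize_melody w = map ((+) (- hd w)) w"

lemma finite_canon_states [simp]: "finite (canon_states S n)"
  by (simp add: canon_states_def)

lemma normalize_melody_in_canon_states:
  assumes "length w = n" "n > 0" "valid_canon S w"
  shows "normalize_melody w \<in> canon_states S n"
proof -
  have "hd (normalize_melody w) = 0"
    using assms by (cases w) (auto simp: normalize_melody_def)
  with assms show ?thesis by (simp add: canon_states_def normalize_melody_def)
qed

text \<open>A nonempty valid canon is determined by its first note and its normalized form, and
  these can be chosen independently. This is the source of the factor 1/7 in the degree
  bound.\<close>

lemma sum_valid_canons_transpose_invariant: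
  fixes F :: "7 list \<Rightarrow> nat"
  assumes "n > 0" and F: "\<And>c w. F (map ((+) c) w) = F w"
  shows "(\<Sum>w | length w = n \<and> valid_canon S w. F w) = 7 * (\<Sum>w\<in>canon_states S n. F w)"
proof -
  let ?h = "\<lambda>(c :: 7, w). map ((+) c) w"
  have hd_h: "hd (?h (c, w)) = c" if "w \<in> canon_states S n" for c w
    using that assms(1) by (cases w) (auto simp: canon_states_def)
  have "bij_betw ?h (UNIV \<times> canon_states S n) {w. length w = n \<and> valid_canon S w}"
  proof (rule bij_betw_byWitness[where f' = "\<lambda>w. (hd w, normalize_melody w)"])
    show "\<forall>p\<in>UNIV \<times> canon_states S n. (hd (?h p), normalize_melody (?h p)) = p"
      using hd_h by (auto simp: normalize_melody_def comp_def map_idI)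
    show "\<forall>w\<in>{w. length w = n \<and> valid_canon S w}. ?h (hd w, normalize_melody w) = w"
      by (auto simp: normalize_melody_def comp_def map_idI)
    show "?h ` (UNIV \<times> canon_states S n) \<subseteq> {w. length w = n \<and> valid_canon S w}"
      by (auto simp: canon_states_def)
    show "(\<lambda>w. (hd w, normalize_melody w)) ` {w. length w = n \<and> valid_canon S w}
        \<subseteq> UNIV \<times> canon_states S n"
      using assms(1) normalize_melody_in_canon_states by auto
  qed
  then have "(\<Sum>w | length w = n \<and> valid_canon S w. F w) =
      (\<Sum>p\<in>UNIV \<times> canon_states S n. F (?h p))"
    by (rule sum.reindex_bij_betw[symmetric])
  also have "\<dots> = (\<Sum>(c, w)\<in>(UNIV :: 7 set) \<times> canon_states S n. F w)"
    by (intro sum.cong) (auto simp: F)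
  also have "\<dots> = 7 * (\<Sum>w\<in>canon_states S n. F w)"
    by (simp flip: sum.cartesian_product)
  finally show ?thesis .
qed

lemma num_canons_eq_card_states: "n > 0 \<Longrightarrow> num_canons S n = 7 * card (canon_states S n)"
  using sum_valid_canons_transpose_invariant[of n "\<lambda>_. 1" S] by (simp add: num_canons_def)

text \<open>Cut after the first s notes: the initial window is a valid canon and the rest is one of
  its extensions.\<close>

lemma num_canons_eq_sum_extensions:
  assumes "s > 0"
  shows "num_canons S (s + n) = 7 * (\<Sum>w\<in>canon_states S s. card (extensions S n w))"
proof -
  let ?V = "{w. length w = s \<and> valid_canon S w}"
  have "bij_betw (\<lambda>(w, zs). w @ zs) (Sigma ?V (extensions S n))
    {xs. length xs = s + n \<and> valid_canon S xs}"
  proof (rule bij_betw_byWitness[where f' = "\<lambda>xs. (take s xs, drop s xs)"])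
    show "(\<lambda>xs. (take s xs, drop s xs)) ` {xs. length xs = s + n \<and> valid_canon S xs}
      \<subseteq> Sigma ?V (extensions S n)"
    proof (clarsimp simp: extensions_def)
      fix xs assume "valid_canon S xs"
      then show "valid_canon S (take s xs)"
        using valid_canon_appendD(1)[of S "take s xs" "drop s xs"] by simp
    qed
  qed (auto simp: extensions_def)
  then have "num_canons S (s + n) = card (Sigma ?V (extensions S n))"
    unfolding num_canons_def by (rule bij_betw_same_card[symmetric])
  also have "\<dots> = (\<Sum>w\<in>?V. card (extensions S n w))" by simp
  also have "\<dots> = 7 * (\<Sum>w\<in>canon_states S s. card (extensions S n w))"
    using assms by (intro sum_valid_canons_transpose_invariant) simp_all
  finally show ?thesis .
qed

section \<open>The transfer matrix\<close>

text \<open>The window slides by one note and is normalized again. An entry can exceed 1 only when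
  \<open>tl w\<close> is empty, since then every \<open>x\<close> leads to the state
  \<open>[0]\<close>.\<close>

definition transfer :: "scheme \<Rightarrow> 7 list \<Rightarrow> 7 list \<Rightarrow> nat" where
  "transfer S w u = card {x. valid_canon S (w @ [x]) \<and> normalize_melody (tl w @ [x]) = u}"

text \<open>After the next note \<open>x\<close> is chosen, the window criterion makes the later
  notes depend only on \<open>tl w @ [x]\<close>, and their number only on its transposition class.
  Grouping the choices of \<open>x\<close> by that class gives the matrix product.\<close>

lemma card_extensions_Suc:
  assumes S: "canonic_scheme S" and len: "length w = total_displacement S" "w \<noteq> []"
  shows "card (extensions S (Suc n) w) =
    (\<Sum>u\<in>canon_states S (length w). transfer S w u * card (extensions S n u))"
proof -
  let ?X = "{x. valid_canon S (w @ [x])}"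
  let ?g = "\<lambda>x. normalize_melody (tl w @ [x])"
  have ext: "x # zs \<in> extensions S (Suc n) w \<longleftrightarrow>
      valid_canon S (w @ [x]) \<and> zs \<in> extensions S n (tl w @ [x])" for x zs
    by (auto simp: extensions_def valid_canon_append_Cons_iff[OF assms, of x zs])
  have "bij_betw (\<lambda>(x, zs). x # zs) (SIGMA x:?X. extensions S n (tl w @ [x])) (extensions S (Suc n) w)"
  proof (rule bij_betw_byWitness[where f' = "\<lambda>xs. (hd xs, tl xs)"])
    show "(\<lambda>(x, zs). x # zs) ` (SIGMA x:?X. extensions S n (tl w @ [x])) \<subseteq> extensions S (Suc n) w"
      by (auto simp: ext)
    show "(\<lambda>xs. (hd xs, tl xs)) ` extensions S (Suc n) w \<subseteq> (SIGMA x:?X. extensions S n (tl w @ [x]))"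
    proof (rule image_subsetI)
      fix xs assume xs: "xs \<in> extensions S (Suc n) w"
      then have "hd xs # tl xs = xs" by (cases xs) (auto simp: extensions_def)
      with xs show "(hd xs, tl xs) \<in> (SIGMA x:?X. extensions S n (tl w @ [x]))"
        using ext[of "hd xs" "tl xs"] by simp
    qed
  qed (auto simp: extensions_def length_Suc_conv)
  then have "card (extensions S (Suc n) w) = card (SIGMA x:?X. extensions S n (tl w @ [x]))"
    by (rule bij_betw_same_card[symmetric])
  also have "\<dots> = (\<Sum>x\<in>?X. card (extensions S n (tl w @ [x])))" by simp
  also have "\<dots> = (\<Sum>x\<in>?X. card (extensions S n (?g x)))"
    by (simp only: normalize_melody_def card_extensions_transpose)
  also have "\<dots> = (\<Sum>u\<in>canon_states S (length w).
      \<Sum>x | x \<in> ?X \<and> ?g x = u. card (extensions S n (?g x)))"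
  proof (rule sum.group[symmetric])
    show "?g ` ?X \<subseteq> canon_states S (length w)"
    proof (intro image_subsetI normalize_melody_in_canon_states)
      fix x assume "x \<in> ?X"
      then have "valid_canon S ([hd w] @ (tl w @ [x]))" using len(2) by (cases w) auto
      then show "valid_canon S (tl w @ [x])" by (rule valid_canon_appendD)
    qed (use len(2) in auto)
  qed auto
  also have "\<dots> = (\<Sum>u\<in>canon_states S (length w). transfer S w u * card (extensions S n u))"
    by (intro sum.cong) (auto simp: transfer_def)
  finally show ?thesis .
qed

section \<open>Existence and algebraicity of the flexibility\<close>

theorem theorem6p1:
  fixes S :: scheme and s :: nat
  assumes "canonic_scheme S"
    and "card (voices S) \<ge> 2"
    and "s = total_displacement S"
  shows "convergent (\<lambda>n. root n (real (num_canons S n))) \<and>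
    algebraic_int (flexibility S) \<and>
    (\<exists>p :: int poly. lead_coeff p = 1 \<and> poly (map_poly of_int p) (flexibility S) = 0 \<and>
       real (degree p) \<le> (if num_canons S s = 0 then 1 else real (num_canons S s) / 7)) \<and>
    real (num_canons S s) / 7 \<le> 7 ^ (s - 1)"
proof -
  let ?V = "num_canons S" and ?Q = "canon_states S s"
  have s: "s > 0" using total_displacement_pos assms by simp
  obtain L where lim: "(\<lambda>n. root n (real (?V n))) \<longlonglongrightarrow> L" and L0: "L \<ge> 0"
    and L_le: "\<And>n. n > 0 \<Longrightarrow> L ^ n \<le> real (?V n)"
    using submultiplicative_root_tendsto[of ?V, OF num_canons_submultiplicative] by blast
  have flex: "flexibility S = L" unfolding flexibility_def using lim by (rule limI)
  have Vs: "?V s = 7 * card ?Q" using s by (rule num_canons_eq_card_states)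
  have root: "\<exists>p :: int poly. lead_coeff p = 1 \<and> poly (map_poly of_int p) L = 0 \<and>
       real (degree p) \<le> (if ?V s = 0 then 1 else real (?V s) / 7)"
  proof (cases "L = 0")
    case True
    \<comment> \<open>The root 0 is covered by the polynomial X. Its degree 1 fits the bound because
      \<open>?V s / 7\<close> is a natural number, hence at least 1 unless it is 0.\<close>
    have "1 \<le> (if ?V s = 0 then 1 else real (?V s) / 7)"
      unfolding Vs by (cases "card ?Q") simp_all
    then show ?thesis using True by (intro exI[of _ "[:0, 1:]"]) simp
  next
    case False
    with L0 have L: "L > 0" by simp
    have "0 < real (?V s)" using L_le[OF s] zero_less_power[OF L, of s] by linarith
    then have Vs0: "?V s > 0" by simp
    have sum_ext: "(\<Sum>w\<in>?Q. real (card (extensions S n w))) = real (?V (s + n)) / 7" for n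
      using num_canons_eq_sum_extensions[OF s, of S n] by simp
    have "\<exists>p :: int poly. lead_coeff p = 1 \<and> degree p = card ?Q \<and> poly (map_poly of_int p) L = 0"
    proof (rule linear_recurrence_growth_rate[of ?Q L
          "\<lambda>n w. real (card (extensions S n w))" "\<lambda>w u. int (transfer S w u)" "L ^ s / 7"])
      show "real (card (extensions S (Suc n) w)) =
          (\<Sum>u\<in>?Q. of_int (int (transfer S w u)) * real (card (extensions S n u)))"
        if "w \<in> ?Q" for n w
      proof -
        have "length w = s" "w \<noteq> []" using that s by (auto simp: canon_states_def)
        then show ?thesis using card_extensions_Suc[OF assms(1), of w n] assms(3) by simp
      qed
      \<comment> \<open>The constant \<open>L ^ s / 7\<close> arises because the entry sum is
        \<open>?V (s + n) / 7\<close> and \<open>?V (s + n)\<close> is at least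
        \<open>L ^ (s + n)\<close>.\<close>
      show "L ^ s / 7 * L ^ n \<le> (\<Sum>w\<in>?Q. real (card (extensions S n w)))" for n
        using L_le[of "s + n"] s by (simp add: sum_ext power_add)
      fix C q :: real and N\<^sub>0
      assume C: "C > 0" and q: "q > 1"
      show "\<exists>N\<ge>N\<^sub>0. (\<Sum>w\<in>?Q. real (card (extensions S N w))) < C * (q * L) ^ N"
      proof (rule ccontr)
        assume "\<not> ?thesis"
        then have big: "C * (q * L) ^ N \<le> real (?V (s + N)) / 7" if "N \<ge> N\<^sub>0" for N
          using that by (auto simp: sum_ext not_less)
        \<comment> \<open>Dividing by \<open>?V s\<close> removes the shift by s, by
          submultiplicativity. Taking N-th roots then yields q L \<le> L in the limit, which is
          absurd.\<close>
        define C' where "C' = 7 * C / real (?V s)"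
        have C': "C' > 0" using C Vs0 by (simp add: C'_def)
        have le: "root N C' * (q * L) \<le> root N (real (?V N))" if N: "N \<ge> N\<^sub>0" "N > 0" for N
        proof -
          have "7 * C * (q * L) ^ N \<le> real (?V (s + N))" using big[OF N(1)] by simp
          also have "\<dots> \<le> real (?V s) * real (?V N)"
            using num_canons_submultiplicative[of S s N] by (simp flip: of_nat_mult)
          finally have "C' * (q * L) ^ N \<le> real (?V N)"
            using Vs0 by (simp add: C'_def field_simps)
          then have "root N (C' * (q * L) ^ N) \<le> root N (real (?V N))"
            using N by (intro real_root_le_mono)
          then show ?thesis
            using N q L by (simp add: real_root_mult real_root_power_cancel)
        qed
        have "(\<lambda>N. root N C' * (q * L)) \<longlonglongrightarrow> 1 * (q * L)"
          using C' by (intro tendsto_intros LIMSEQ_root_const)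
        then have "1 * (q * L) \<le> L"
          using lim
        proof (rule LIMSEQ_le)
          show "\<exists>M. \<forall>N\<ge>M. root N C' * (q * L) \<le> root N (real (?V N))"
            using le by (intro exI[of _ "Suc N\<^sub>0"] allI impI) simp
        qed
        with q L show False by simp
      qed
    qed (use L s in auto)
    then obtain p :: "int poly" where "lead_coeff p = 1" "degree p = card ?Q"
      "poly (map_poly of_int p) L = 0"
      by blast
    then show ?thesis using Vs Vs0 by (intro exI[of _ p]) auto
  qed
  moreover have "algebraic_int L"
    unfolding algebraic_int_altdef_ipoly using root by blast
  moreover have "convergent (\<lambda>n. root n (real (?V n)))"
    using lim by (rule convergentI)
  moreover have "real (?V s) / 7 \<le> 7 ^ (s - 1)"
  proof -
    have "real (?V s) \<le> 7 ^ s"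
      using of_nat_mono[OF num_canons_le[of S s], where 'a = real] by simp
    also have "\<dots> = 7 * 7 ^ (s - 1)" using s by (cases s) simp_all
    finally show ?thesis by simp
  qed
  ultimately show ?thesis
    unfolding flex by (intro conjI)
qed

end
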